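(* Let $(G,A)$ be a simple edge-weighted graph with vertices $v_1,\dots,v_n$, and let $M_1,\dots,M_n$ be a flow-up class basis of $S_G$ with $M_i\in\mathcal{F}_{i-1}$. For $i\neq j$ let $\mathcal{P}_{ij}$ be the set of paths in $G$ from $v_i$ to $v_j$, and let $[\mathcal{P}_{ij}]$ denote the least common multiple, over all $p\in\mathcal{P}_{ij}$, of $(p)$, the greatest common divisor of the weights of the edges of $p$. Then $L(M_1)=1$, and for $i>1$, $$L(M_i)=\operatorname{lcm}\big([\mathcal{P}_{i1}],[\mathcal{P}_{i2}],\dots,[\mathcal{P}_{i,i-1}]\big).$$
   Context: An edge-weighted graph $(G,A)$ is a finite simple graph $G$ with vertex set $\{v_1,\dots,v_n\}$ and edge set $E$ with a weight function $A:E\to\mathbb{Z}_{>0}$. A spline on $(G,A)$ is $(g_1,\dots,g_n)\in\mathbb{Z}^n$ with $g_i\equiv g_j\pmod{A(e)}$ for every edge $e$ joining $v_i$ and $v_j$; $S_G$ is the $\mathbb{Z}$-module of splines. A path from $v_i$ to $v_j$ is a sequence of distinct vertices $v_i=x_0,x_1,\dots,x_k=v_j$ with $x_{t-1}x_t$ an edge for each $t$. Flow-up classes: for $0\le i<n$, $\mathcal{F}_i$ is the set of splines with $g_1=\cdots=g_i=0$ and $g_{i+1}\ne0$; $\mathcal{F}_n=\{0\}$. For $F\in\mathcal{F}_i$ ($i<n$), the leading term is $L(F)=g_{i+1}$. A minimal element of $\mathcal{F}_i$ is $B\in\mathcal{F}_i$ with $L(B)>0$ and $L(B)\le|L(F)|$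 for all $F\in\mathcal{F}_i$. A flow-up class basis of $S_G$ is a $\mathbb{Z}$-basis consisting of one minimal element from each $\mathcal{F}_i$, $0\le i<n$. The lcm of an empty set of integers is taken to be $1$. *)

theory Defs
  imports Complex_Main "HOL-Library.Function_Algebras" "HOL-Number_Theory.Cong"
begin

text \<open>
  The vertex \<open>v\<^sub>i\<close> is represented by its index \<open>i \<in> {1..n}\<close>, an edge by the two-element set of its
  endpoints. The values of \<open>A\<close> outside \<open>E\<close> are never used.
\<close>

definition edge_weighted_graph :: "nat \<Rightarrow> nat set set \<Rightarrow> (nat set \<Rightarrow> int) \<Rightarrow> bool" where
  "edge_weighted_graph n E A \<longleftrightarrow>
     (\<forall>e\<in>E. e \<subseteq> {1..n} \<and> card e = 2) \<and> (\<forall>e\<in>E. A e > 0)"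

text \<open>
  \<open>\<int>\<^sup>n\<close> is represented by the functions \<open>nat \<Rightarrow> int\<close> vanishing outside \<open>{1..n}\<close>, so that equality of
  splines is equality of functions.
\<close>

definition splines :: "nat \<Rightarrow> nat set set \<Rightarrow> (nat set \<Rightarrow> int) \<Rightarrow> (nat \<Rightarrow> int) set" where
  "splines n E A =
     {g. (\<forall>i. i \<notin> {1..n} \<longrightarrow> g i = 0) \<and>
         (\<forall>i j. {i, j} \<in> E \<longrightarrow> [g i = g j] (mod A {i, j}))}"

definition zscale :: "int \<Rightarrow> (nat \<Rightarrow> int) \<Rightarrow> nat \<Rightarrow> int" where
  "zscale c g = (\<lambda>i. c * g i)"

lemma module_zscale: "module zscale"
  by unfold_locales (auto simp: zscale_def plus_fun_def algebra_simps)

lemma subspace_splines: "module.subspace zscale (splines n E A)"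
  by (auto simp: module.subspace_def[OF module_zscale] splines_def zscale_def
      plus_fun_def zero_fun_def intro: cong_add cong_scalar_left)

definition Z_basis :: "(nat \<Rightarrow> int) set \<Rightarrow> (nat \<Rightarrow> int) set \<Rightarrow> bool" where
  "Z_basis B S \<longleftrightarrow> \<not> module.dependent zscale B \<and> module.span zscale B = S"

definition flow_up :: "nat \<Rightarrow> nat set set \<Rightarrow> (nat set \<Rightarrow> int) \<Rightarrow> nat \<Rightarrow> (nat \<Rightarrow> int) set" where
  "flow_up n E A i =
     (if i < n then {g \<in> splines n E A. (\<forall>j\<in>{1..i}. g j = 0) \<and> g (i + 1) \<noteq> 0} else {0})"

definition leading_term :: "nat \<Rightarrow> nat set set \<Rightarrow> (nat set \<Rightarrow> int) \<Rightarrow> (nat \<Rightarrow> int) \<Rightarrow> int" where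
  "leading_term n E A F = F ((THE i. i < n \<and> F \<in> flow_up n E A i) + 1)"

lemma leading_term_flow_up:
  assumes "i < n" "F \<in> flow_up n E A i"
  shows "leading_term n E A F = F (i + 1)"
proof -
  have "(THE k. k < n \<and> F \<in> flow_up n E A k) = i"
  proof (rule the_equality)
    fix k assume k: "k < n \<and> F \<in> flow_up n E A k"
    show "k = i"
    proof (rule linorder_cases)
      assume "k < i"
      then show ?thesis using assms k by (auto simp: flow_up_def)
    next
      assume "i < k"
      then show ?thesis using assms k by (auto simp: flow_up_def)
    qed
  qed (use assms in auto)
  then show ?thesis by (simp add: leading_term_def)
qed

definition minimal_element ::
    "nat \<Rightarrow> nat set set \<Rightarrow> (nat set \<Rightarrow> int) \<Rightarrow> nat \<Rightarrow> (nat \<Rightarrow> int) \<Rightarrow> bool" where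
  "minimal_element n E A i B \<longleftrightarrow>
     i < n \<and> B \<in> flow_up n E A i \<and> leading_term n E A B > 0 \<and>
     (\<forall>F\<in>flow_up n E A i. leading_term n E A B \<le> \<bar>leading_term n E A F\<bar>)"

text \<open>The \<open>M i\<close> are automatically distinct, as the flow-up classes are pairwise disjoint.\<close>

definition flow_up_class_basis ::
    "nat \<Rightarrow> nat set set \<Rightarrow> (nat set \<Rightarrow> int) \<Rightarrow> (nat \<Rightarrow> nat \<Rightarrow> int) \<Rightarrow> bool" where
  "flow_up_class_basis n E A M \<longleftrightarrow>
     Z_basis (M ` {1..n}) (splines n E A) \<and>
     (\<forall>i\<in>{1..n}. minimal_element n E A (i - 1) (M i))"

definition paths :: "nat set set \<Rightarrow> nat \<Rightarrow> nat \<Rightarrow> nat list set" where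
  "paths E i j =
     {p. p \<noteq> [] \<and> hd p = i \<and> last p = j \<and> distinct p \<and>
         (\<forall>t. Suc t < length p \<longrightarrow> {p ! t, p ! Suc t} \<in> E)}"

definition path_edges :: "nat list \<Rightarrow> nat set set" where
  "path_edges p = {{p ! t, p ! Suc t} | t. Suc t < length p}"

definition path_gcd :: "(nat set \<Rightarrow> int) \<Rightarrow> nat list \<Rightarrow> int" where
  "path_gcd A p = Gcd (A ` path_edges p)"

text \<open>\<^const>\<open>Lcm\<close> of the empty set is \<open>1\<close>, which is the value if there is no path from \<open>i\<close> to \<open>j\<close>.\<close>

definition paths_lcm :: "nat set set \<Rightarrow> (nat set \<Rightarrow> int) \<Rightarrow> nat \<Rightarrow> nat \<Rightarrow> int" where
  "paths_lcm E A i j = Lcm (path_gcd A ` paths E i j)"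

end

theory Submission
  imports Defs
begin

text \<open>
  Fix \<open>i\<close>, let \<open>m\<close> be the leading term of the minimal element and \<open>L\<close> the claimed value. Along
  a path \<open>p\<close> from \<open>v\<^sub>i\<close> to \<open>v\<^sub>j\<close> every spline is constant modulo \<open>(p)\<close>, so \<open>L\<close> divides \<open>m\<close>.
  Conversely, by division with remainder, \<open>m\<close> divides the \<open>i\<close>-th entry of each spline vanishing on
  \<open>v\<^sub>1, \<dots>, v\<^sub>i\<^sub>-\<^sub>1\<close>. For a prime \<open>p\<close> with \<open>p\<^sup>a\<close> exactly dividing \<open>L\<close>, take the vertices reachable from
  \<open>v\<^sub>i\<close> along edges whose weight is divisible by \<open>p\<^sup>a\<^sup>+\<^sup>1\<close>; none of \<open>v\<^sub>1, \<dots>, v\<^sub>i\<^sub>-\<^sub>1\<close> is among them, and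
  \<open>L\<close> times their indicator function becomes a spline after multiplication by an integer prime to
  \<open>p\<close>. Hence \<open>m\<close> divides \<open>L\<close> locally at every prime.
\<close>

lemma spline_cong_along_path:
  assumes g: "g \<in> splines n E A" and p: "p \<in> paths E i j"
  shows "path_gcd A p dvd g i - g j"
proof -
  \<comment> \<open>The differences along consecutive edges telescope; the last index
    \<open>t = length p - 1\<close> gives the endpoint \<open>j\<close>.\<close>
  have "path_gcd A p dvd g (p ! 0) - g (p ! t)" if "t < length p" for t
    using that
  proof (induction t)
    case (Suc t)
    have "path_gcd A p dvd A {p ! t, p ! Suc t}"
      unfolding path_gcd_def by (rule Gcd_dvd) (use Suc.prems in \<open>auto simp: path_edges_def\<close>)
    moreover have "A {p ! t, p ! Suc t} dvd g (p ! t) - g (p ! Suc t)"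
      using g p Suc.prems by (auto simp: splines_def paths_def cong_iff_dvd_diff)
    ultimately have "path_gcd A p dvd g (p ! t) - g (p ! Suc t)"
      by (rule dvd_trans)
    then have "path_gcd A p dvd (g (p ! 0) - g (p ! t)) + (g (p ! t) - g (p ! Suc t))"
      using Suc by (intro dvd_add) auto
    then show ?case by simp
  qed simp
  from this[of "length p - 1"] show ?thesis
    using p by (auto simp: paths_def hd_conv_nth last_conv_nth)
qed

lemma Lcm_paths_dvd_entry:
  assumes "g \<in> splines n E A" and "\<forall>j\<in>{1..i - 1}. g j = 0"
  shows "Lcm ((\<lambda>j. paths_lcm E A i j) ` {1..i - 1}) dvd g i"
proof (rule Lcm_least, clarify)
  fix j assume "j \<in> {1..i - 1}"
  then have "path_gcd A p dvd g i" if "p \<in> paths E i j" for p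
    using spline_cong_along_path[OF assms(1) that] assms(2) by simp
  then show "paths_lcm E A i j dvd g i"
    unfolding paths_lcm_def by (intro Lcm_least) auto
qed

text \<open>Makes the set of vertices reachable from \<open>i\<close> closed under edges. Paths must
  stay distinct, so if \<open>v\<close> already lies on \<open>p\<close>, the path is cut off at
  \<open>v\<close>; otherwise \<open>v\<close> is appended.\<close>

lemma paths_extend:
  assumes p: "p \<in> paths E i u" and e: "{u, v} \<in> E"
  shows "\<exists>q. q \<in> paths E i v"
proof (cases "v \<in> set p")
  case True
  then obtain xs ys where p_eq: "p = (xs @ [v]) @ ys"
    by (metis append_Cons append_Nil append_assoc split_list)
  have "{(xs @ [v]) ! t, (xs @ [v]) ! Suc t} \<in> E" if "Suc t < length (xs @ [v])" for t
  proof -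
    have "{p ! t, p ! Suc t} \<in> E"
      using p that by (auto simp: paths_def p_eq)
    then show ?thesis
      using that unfolding p_eq by (simp only: nth_append_left Suc_lessD)
  qed
  moreover have "hd (xs @ [v]) = i" "distinct (xs @ [v])"
    using p unfolding paths_def p_eq by (auto simp: hd_append split: if_splits)
  ultimately have "xs @ [v] \<in> paths E i v"
    by (simp add: paths_def)
  then show ?thesis ..
next
  case False
  have "{(p @ [v]) ! t, (p @ [v]) ! Suc t} \<in> E" if "Suc t < length (p @ [v])" for t
  proof (cases "Suc t < length p")
    case True
    then show ?thesis using p by (auto simp: paths_def nth_append)
  next
    case False
    with that have "t = length p - 1" "Suc t = length p" by auto
    moreover have "p ! (length p - 1) = u"
      using p by (auto simp: paths_def last_conv_nth)
    ultimately show ?thesis using e by (simp add: nth_append)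
  qed
  then have "p @ [v] \<in> paths E i v"
    using p False by (auto simp: paths_def)
  then show ?thesis ..
qed

lemma minimal_element_dvd:
  assumes M: "minimal_element n E A k B"
    and F: "F \<in> splines n E A" "\<forall>j\<in>{1..k}. F j = 0"
  shows "B (k + 1) dvd F (k + 1)"
proof -
  have k: "k < n" and B: "B \<in> flow_up n E A k"
    using M by (auto simp: minimal_element_def)
  have lt: "leading_term n E A G = G (k + 1)" if "G \<in> flow_up n E A k" for G
    using leading_term_flow_up[OF k that] .
  have pos: "B (k + 1) > 0" and le: "\<And>G. G \<in> flow_up n E A k \<Longrightarrow> B (k + 1) \<le> \<bar>G (k + 1)\<bar>"
    using M B lt unfolding minimal_element_def by fastforce+
  define c where "c = F (k + 1) div B (k + 1)"
  \<comment> \<open>The entry of \<open>G\<close> at \<open>k + 1\<close> is a remainder below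
    \<open>B (k + 1)\<close>; were it nonzero, \<open>G\<close> would contradict the minimality of
    \<open>B\<close>.\<close>
  define G where "G = (\<lambda>u. F u - c * B u)"
  have B_spline: "B \<in> splines n E A" and B_zero: "\<forall>j\<in>{1..k}. B j = 0"
    using B k by (auto simp: flow_up_def)
  have G_spline: "G \<in> splines n E A"
    using F(1) B_spline unfolding G_def splines_def by (auto intro!: cong_diff cong_mult cong_refl)
  have G_mod: "G (k + 1) = F (k + 1) mod B (k + 1)"
    unfolding G_def c_def by (simp add: minus_div_mult_eq_mod)
  show ?thesis
  proof (rule ccontr)
    assume "\<not> ?thesis"
    then have "G (k + 1) \<noteq> 0" unfolding G_mod by (simp add: mod_eq_0_iff_dvd)
    then have "G \<in> flow_up n E A k"
      using k G_spline F(2) B_zero by (auto simp: flow_up_def G_def)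
    from le[OF this] show False
      using pos pos_mod_bound[OF pos, of "F (k + 1)"] pos_mod_sign[OF pos, of "F (k + 1)"]
      unfolding G_mod by linarith
  qed
qed

lemma p_local_spline:
  fixes p :: int and E :: "nat set set" and A :: "nat set \<Rightarrow> int" and i :: nat
  defines "L \<equiv> Lcm ((\<lambda>j. paths_lcm E A i j) ` {1..i - 1})"
  assumes graph: "edge_weighted_graph n E A" and i: "i \<in> {1..n}"
    and p: "prime p" and L0: "L \<noteq> 0"
  obtains F N where "F \<in> splines n E A" "\<forall>j\<in>{1..i - 1}. F j = 0" "F i = N * L" "\<not> p dvd N"
proof -
  define a where "a = multiplicity p L"
  define E' where "E' = {e \<in> E. p ^ Suc a dvd A e}"
  define C where "C = {u. \<exists>q. q \<in> paths E' i u}"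
  \<comment> \<open>\<open>r e\<close> is the part of the weight prime to \<open>p\<close>; the
    product \<open>N\<close> clears all these parts at once.\<close>
  define r where "r = (\<lambda>e. A e div p ^ multiplicity p (A e))"
  define N where "N = prod r E"
  define F where "F = (\<lambda>u. if u \<in> {1..n} \<inter> C then N * L else 0)"
  have fin: "finite E"
    by (rule finite_subset[of _ "Pow {1..n}"]) (use graph in \<open>auto simp: edge_weighted_graph_def\<close>)
  have Apos: "A e \<noteq> 0" if "e \<in> E" for e
    using graph that by (auto simp: edge_weighted_graph_def)
  have p_not_unit: "\<not> is_unit p" using p not_prime_unit by blast
  have A_eq: "A e = p ^ multiplicity p (A e) * r e" for e
    unfolding r_def by (simp add: multiplicity_dvd)
  have r: "\<not> p dvd r e" if "e \<in> E" for e
    unfolding r_def using Apos[OF that] p_not_unit by (rule multiplicity_decompose)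
  have N: "\<not> p dvd N"
    unfolding N_def using r by (simp add: prime_dvd_prod_iff[OF fin p])
  \<comment> \<open>Only edges outside \<open>E'\<close> can leave \<open>C\<close>. There the
    \<open>p\<close>-part of the weight is at most \<open>p ^ a\<close>, hence divides
    \<open>L\<close>, and the rest divides \<open>N\<close>, so a jump of \<open>F\<close> from
    \<open>N * L\<close> to 0 is allowed.\<close>
  have boundary: "A e dvd N * L" if "e \<in> E" "e \<notin> E'" for e
  proof -
    have "\<not> p ^ Suc a dvd A e" using that by (simp add: E'_def)
    then have "multiplicity p (A e) \<le> a"
      by (meson multiplicity_dvd' not_less_eq_eq)
    then have "p ^ multiplicity p (A e) dvd L"
      unfolding a_def by (rule multiplicity_dvd')
    moreover have "r e dvd N" unfolding N_def using fin that by (intro dvd_prodI) auto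
    ultimately show ?thesis by (subst A_eq) (metis mult_dvd_mono mult.commute)
  qed
  have closed: "v \<in> C" if "u \<in> C" "{u, v} \<in> E'" for u v
    using that paths_extend[of _ E' i u v] by (auto simp: C_def)
  have "F \<in> splines n E A"
    unfolding splines_def
  proof (safe)
    fix u v assume e: "{u, v} \<in> E"
    then have uv: "u \<in> {1..n}" "v \<in> {1..n}"
      using graph by (auto simp: edge_weighted_graph_def)
    show "[F u = F v] (mod A {u, v})"
    proof (cases "{u, v} \<in> E'")
      case True
      then have "u \<in> C \<longleftrightarrow> v \<in> C" using closed[of u v] closed[of v u] by (auto simp: insert_commute)
      then show ?thesis using uv by (simp add: F_def)
    next
      case False
      from boundary[OF e this] show ?thesis
        by (auto simp: F_def cong_iff_dvd_diff)
    qed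
  qed (auto simp: F_def)
  \<comment> \<open>A path inside \<open>E'\<close> from \<open>i\<close> to \<open>j\<close> would
    have a gcd divisible by \<open>p ^ Suc a\<close>, yet this gcd divides \<open>L\<close>.\<close>
  moreover have "j \<notin> C" if j: "j \<in> {1..i - 1}" for j
  proof
    assume "j \<in> C"
    then obtain q where q: "q \<in> paths E' i j" by (auto simp: C_def)
    then have "q \<in> paths E i j" by (auto simp: paths_def E'_def)
    then have "path_gcd A q dvd paths_lcm E A i j"
      unfolding paths_lcm_def by (intro dvd_Lcm) auto
    also have "\<dots> dvd L"
      unfolding L_def using j by (intro dvd_Lcm) auto
    finally have "path_gcd A q dvd L" .
    moreover have "p ^ Suc a dvd path_gcd A q"
      unfolding path_gcd_def
      by (rule Gcd_greatest) (use q in \<open>auto simp: path_edges_def paths_def E'_def\<close>)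
    ultimately have "p ^ Suc a dvd L" by (rule dvd_trans[rotated])
    then show False
      using power_dvd_iff_le_multiplicity[OF L0 p_not_unit, of "Suc a"] by (simp add: a_def)
  qed
  then have "\<forall>j\<in>{1..i - 1}. F j = 0" by (auto simp: F_def)
  \<comment> \<open>Witnessed by the one-vertex path, which has no edges.\<close>
  moreover have "i \<in> C"
    unfolding C_def by (auto simp: paths_def intro!: exI[of _ "[i]"])
  then have "F i = N * L" using i by (simp add: F_def)
  ultimately show ?thesis using that N by blast
qed

text \<open>After cancelling the gcd, any prime factor of the remaining part of \<open>m\<close>
  would have to divide its own multiplier \<open>N\<close>.\<close>

lemma dvd_if_locally_dvd:
  fixes m l :: int
  assumes "m \<noteq> 0" and local: "\<And>p. prime p \<Longrightarrow> \<exists>N. \<not> p dvd N \<and> m dvd N * l"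
  shows "m dvd l"
proof (rule ccontr)
  assume "\<not> m dvd l"
  define d where "d = gcd m l"
  have d0: "d \<noteq> 0" using assms(1) by (simp add: d_def)
  obtain m' l' where m': "m = m' * d" and l': "l = l' * d" and cop: "coprime m' l'"
    using gcd_coprime_exists[of m l] d0 unfolding d_def by blast
  have "\<not> is_unit m'"
    using \<open>\<not> m dvd l\<close> m' l' by (meson dvd_trans mult_dvd_mono dvd_refl one_dvd)
  moreover have "m' \<noteq> 0" using assms(1) m' by auto
  ultimately obtain p where p: "prime p" "p dvd m'"
    using prime_divisor_exists by blast
  from local[OF p(1)] obtain N where N: "\<not> p dvd N" "m dvd N * l" by blast
  then have "m' dvd N * l'" using d0 by (simp add: m' l' mult.assoc[symmetric])
  then have "m' dvd N" using cop by (simp add: coprime_dvd_mult_left_iff)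
  then show False using p N(1) dvd_trans by blast
qed

lemma minimal_element_leading_term:
  assumes graph: "edge_weighted_graph n E A" and i: "i \<in> {1..n}"
    and M: "minimal_element n E A (i - 1) B"
  shows "leading_term n E A B = Lcm ((\<lambda>j. paths_lcm E A i j) ` {1..i - 1})" (is "_ = ?L")
proof -
  have i1: "i - 1 < n" "i - 1 + 1 = i" using i by auto
  have B: "B \<in> flow_up n E A (i - 1)" using M by (simp add: minimal_element_def)
  have lt: "leading_term n E A B = B i"
    using leading_term_flow_up[OF i1(1) B] i1(2) by simp
  then have pos: "B i > 0" using M by (simp add: minimal_element_def)
  have "?L dvd B i"
    using B i1 by (intro Lcm_paths_dvd_entry) (auto simp: flow_up_def)
  \<comment> \<open>\<open>Lcm\<close> can be 0, for instance on infinite sets; dividing the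
    positive \<open>B i\<close> excludes this without counting paths.\<close>
  moreover from this have L0: "?L \<noteq> 0" using pos by auto
  have "B i dvd ?L"
  proof (rule dvd_if_locally_dvd)
    fix p :: int assume p: "prime p"
    obtain F N where F: "F \<in> splines n E A" "\<forall>j\<in>{1..i - 1}. F j = 0"
      and N: "F i = N * ?L" "\<not> p dvd N"
      using p_local_spline[OF graph i p L0] .
    have "B i dvd F i" using minimal_element_dvd[OF M F] unfolding i1(2) .
    then show "\<exists>N. \<not> p dvd N \<and> B i dvd N * ?L" using N by auto
  qed (use pos in simp)
  ultimately have "normalize (B i) = normalize ?L" by (intro associatedI)
  then show ?thesis using pos lt by simp
qed

theorem theorem5p4:
  fixes n :: nat and E :: "nat set set" and A :: "nat set \<Rightarrow> int" and M :: "nat \<Rightarrow> nat \<Rightarrow> int"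
  assumes "1 \<le> n"
    and "edge_weighted_graph n E A"
    and "flow_up_class_basis n E A M"
  shows "leading_term n E A (M 1) = 1 \<and>
    (\<forall>i. 1 < i \<and> i \<le> n \<longrightarrow>
       leading_term n E A (M i) = Lcm ((\<lambda>j. paths_lcm E A i j) ` {1..i - 1}))"
proof -
  have *: "leading_term n E A (M i) = Lcm ((\<lambda>j. paths_lcm E A i j) ` {1..i - 1})"
    if "i \<in> {1..n}" for i
    using minimal_element_leading_term[OF assms(2) that] assms(3) that
    by (simp add: flow_up_class_basis_def)
  \<comment> \<open>For \<open>i = 1\<close> the index set is empty, so the \<open>Lcm\<close> is
    1.\<close>
  from *[of 1] * show ?thesis using assms(1) by simp
qed

end
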